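(* Let $(\mathbb{Z},b,\mathcal{D})$ be a pre-number system with $|b|\ge 3$, and for $t\in\mathbb{Z}$ define $\mathcal{D}_t=\{d+t \mid d\in\mathcal{D}\}$. Then there are only finitely many $t\in\mathbb{Z}$ such that $(\mathbb{Z},b,\mathcal{D}_t)$ is a number system. Moreover, if $0\in\mathcal{D}$, then the same statement holds for $\tilde{\mathcal{D}}_t=\{d+t\mid d\in\mathcal{D},\,d\ne 0\}\cup\{0\}$: there are only finitely many $t\in\mathbb{Z}$ such that $(\mathbb{Z},b,\tilde{\mathcal{D}}_t)$ is a number system.
   Context: A pre-number system $(\mathbb{Z},b,\mathcal{D})$ consists of an integer $b$ with $|b|\ge 2$ and a finite set $\mathcal{D}\subset\mathbb{Z}$ covering all residue classes modulo $b$; $\mathcal{D}$ is assumed irredundant, i.e. $|\mathcal{D}|=|b|$, so it has exactly one element in each residue class. A pre-number system is a number system if every $a\in\mathbb{Z}$ can be written as $a=\sum_{i=0}^{\ell-1}d_ib^i$ with $\ell\ge 1$ and all $d_i\in\mathcal{D}$. In particular, a triple that is not a pre-number system is not a number system. *)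

theory Defs
  imports "HOL-Number_Theory.Cong"
begin

definition pre_number_system :: "int \<Rightarrow> int set \<Rightarrow> bool" where
  "pre_number_system b D \<longleftrightarrow>
     \<bar>b\<bar> \<ge> 2 \<and> finite D \<and> (\<forall>a. \<exists>d\<in>D. [a = d] (mod b)) \<and> int (card D) = \<bar>b\<bar>"

definition number_system :: "int \<Rightarrow> int set \<Rightarrow> bool" where
  "number_system b D \<longleftrightarrow>
     pre_number_system b D \<and>
     (\<forall>a. \<exists>l\<ge>1. \<exists>d :: nat \<Rightarrow> int. (\<forall>i<l. d i \<in> D) \<and> a = (\<Sum>i<l. d i * b ^ i))"

definition translate_digits :: "int set \<Rightarrow> int \<Rightarrow> int set" where
  "translate_digits D t = {d + t | d. d \<in> D}"

definition translate_nonzero_digits :: "int set \<Rightarrow> int \<Rightarrow> int set" where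
  "translate_nonzero_digits D t = {d + t | d. d \<in> D \<and> d \<noteq> 0} \<union> {0}"

end

theory Submission
  imports Defs
begin

text \<open>
  If all nonzero digits have absolute values in \<open>{A..(\<bar>b\<bar> - 1) * A}\<close>, then no nonzero integer of
  absolute value below \<open>A\<close> has an expansion: splitting off the lowest digit gives \<open>a = d + b * a'\<close>,
  and if \<open>\<bar>a'\<bar> \<ge> A\<close>, then \<open>\<bar>a\<bar> \<ge> \<bar>b\<bar> * A - \<bar>d\<bar> \<ge> A\<close>. In particular \<open>1\<close> has no expansion once
  \<open>A \<ge> 2\<close>. Translating a fixed finite digit set by \<open>t\<close> puts all nonzero digits within a bounded
  distance \<open>M\<close> of \<open>t\<close>, so for \<open>\<bar>b\<bar> \<ge> 3\<close> and large \<open>\<bar>t\<bar>\<close> one can take \<open>A = \<bar>t\<bar> - M\<close>.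
\<close>

lemma abs_digit_plus_mult_ge:
  fixes a b d A :: "'a :: linordered_idom"
  assumes "A \<le> \<bar>a\<bar>" and "\<bar>d\<bar> \<le> (\<bar>b\<bar> - 1) * A"
  shows "A \<le> \<bar>d + b * a\<bar>"
proof -
  have "\<bar>b\<bar> * A \<le> \<bar>b * a\<bar>"
    using assms(1) by (simp add: abs_mult mult_left_mono)
  also have "\<dots> \<le> \<bar>d + b * a\<bar> + \<bar>d\<bar>"
    using abs_triangle_ineq4[of "d + b * a" d] by simp
  finally show ?thesis
    using assms(2) by (simp add: left_diff_distrib)
qed

lemma abs_digit_sum_ge:
  fixes b A :: "'a :: linordered_idom" and d :: "nat \<Rightarrow> 'a"
  assumes "1 \<le> \<bar>b\<bar>" and "0 \<le> A"
    and "\<And>i. i < l \<Longrightarrow> d i = 0 \<or> \<bar>d i\<bar> \<in> {A..(\<bar>b\<bar> - 1) * A}"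
    and "(\<Sum>i<l. d i * b ^ i) \<noteq> 0"
  shows "A \<le> \<bar>\<Sum>i<l. d i * b ^ i\<bar>"
  using assms(3,4)
proof (induction l arbitrary: d)
  case 0
  then show ?case by simp
next
  case (Suc l)
  define a' where "a' = (\<Sum>i<l. d (Suc i) * b ^ i)"
  have split_low: "(\<Sum>i<Suc l. d i * b ^ i) = d 0 + b * a'"
    unfolding a'_def sum.lessThan_Suc_shift by (simp add: sum_distrib_left mult.left_commute)
  have low: "d 0 = 0 \<or> \<bar>d 0\<bar> \<in> {A..(\<bar>b\<bar> - 1) * A}"
    using Suc.prems(1) by simp
  have "A \<le> \<bar>d 0 + b * a'\<bar>"
  proof (cases "a' = 0")
    case True
    then show ?thesis using low Suc.prems(2) split_low by simp
  next
    case False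
    then have "A \<le> \<bar>a'\<bar>"
      unfolding a'_def using Suc.prems(1) by (intro Suc.IH) simp_all
    moreover have "\<bar>d 0\<bar> \<le> (\<bar>b\<bar> - 1) * A"
    proof -
      have "0 \<le> (\<bar>b\<bar> - 1) * A"
        using assms(1,2) by simp
      with low show ?thesis by auto
    qed
    ultimately show ?thesis by (intro abs_digit_plus_mult_ge)
  qed
  then show ?case by (simp only: split_low)
qed

lemma number_system_min_nonzero_digit_le_1:
  assumes "number_system b D" and "0 \<le> A"
    and digits: "\<And>d. d \<in> D \<Longrightarrow> d = 0 \<or> \<bar>d\<bar> \<in> {A..(\<bar>b\<bar> - 1) * A}"
  shows "A \<le> 1"
proof -
  obtain l and d :: "nat \<Rightarrow> int"
    where "\<forall>i<l. d i \<in> D" and one: "1 = (\<Sum>i<l. d i * b ^ i)"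
    using assms(1) unfolding number_system_def by metis
  moreover have "1 \<le> \<bar>b\<bar>"
    using assms(1) by (simp add: number_system_def pre_number_system_def)
  ultimately have "A \<le> \<bar>\<Sum>i<l. d i * b ^ i\<bar>"
    using assms(2) by (intro abs_digit_sum_ge digits) auto
  with one show ?thesis by simp
qed

lemma number_system_near_translate_bound:
  assumes "number_system b D" and "3 \<le> \<bar>b\<bar>" and "0 \<le> M"
    and near: "\<And>d. d \<in> D \<Longrightarrow> d = 0 \<or> \<bar>d - t\<bar> \<le> M"
  shows "\<bar>t\<bar> \<le> 3 * M + 1"
proof (rule ccontr)
  assume "\<not> \<bar>t\<bar> \<le> 3 * M + 1"
  then have large: "3 * M + 2 \<le> \<bar>t\<bar>" by simp
  then have "\<bar>t\<bar> + M \<le> 2 * (\<bar>t\<bar> - M)" by simp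
  also have "\<dots> \<le> (\<bar>b\<bar> - 1) * (\<bar>t\<bar> - M)"
    using assms(2,3) large by (intro mult_right_mono) auto
  finally have upper: "\<bar>t\<bar> + M \<le> (\<bar>b\<bar> - 1) * (\<bar>t\<bar> - M)" .
  have "\<bar>t\<bar> - M \<le> 1"
  proof (rule number_system_min_nonzero_digit_le_1[OF assms(1)])
    show "0 \<le> \<bar>t\<bar> - M"
      using large assms(3) by simp
    fix d
    assume "d \<in> D"
    from near[OF this] have "d = 0 \<or> \<bar>d\<bar> \<in> {\<bar>t\<bar> - M..\<bar>t\<bar> + M}" by auto
    with upper show "d = 0 \<or> \<bar>d\<bar> \<in> {\<bar>t\<bar> - M..(\<bar>b\<bar> - 1) * (\<bar>t\<bar> - M)}" by auto
  qed
  with large assms(3) show False by simp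
qed

lemma finite_number_system_translates:
  fixes b :: int and D :: "int set" and E :: "int \<Rightarrow> int set"
  assumes "3 \<le> \<bar>b\<bar>" and "finite D" and E: "\<And>t. E t \<subseteq> insert 0 ((\<lambda>d. d + t) ` D)"
  shows "finite {t. number_system b (E t)}"
proof (rule finite_subset)
  define M where "M = Max (abs ` insert 0 D)"
  have M: "\<bar>d\<bar> \<le> M" if "d \<in> insert 0 D" for d
    unfolding M_def using that assms(2) by (intro Max_ge) auto
  show "{t. number_system b (E t)} \<subseteq> {- (3 * M + 1)..3 * M + 1}"
  proof
    fix t
    assume "t \<in> {t. number_system b (E t)}"
    then have "number_system b (E t)" by simp
    then have "\<bar>t\<bar> \<le> 3 * M + 1"
      using assms(1)
    proof (rule number_system_near_translate_bound)
      show "0 \<le> M"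
        using M[of 0] by simp
      show "e = 0 \<or> \<bar>e - t\<bar> \<le> M" if "e \<in> E t" for e
        using subsetD[OF E that] M by auto
    qed
    then show "t \<in> {- (3 * M + 1)..3 * M + 1}" by (simp add: abs_le_iff)
  qed
qed simp

theorem theorem2p18:
  fixes b :: int and D :: "int set"
  assumes "pre_number_system b D" and "\<bar>b\<bar> \<ge> 3"
  shows "finite {t. number_system b (translate_digits D t)} \<and>
         (0 \<in> D \<longrightarrow> finite {t. number_system b (translate_nonzero_digits D t)})"
proof -
  have "finite D"
    using assms(1) by (simp add: pre_number_system_def)
  note finite_translates = finite_number_system_translates[OF assms(2) this]
  have "finite {t. number_system b (translate_digits D t)}"
    by (rule finite_translates) (auto simp: translate_digits_def)
  moreover have "finite {t. number_system b (translate_nonzero_digits D t)}"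
    by (rule finite_translates) (auto simp: translate_nonzero_digits_def)
  ultimately show ?thesis by blast
qed

end
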